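(* Let $n \geq 3$. Every real $n$-dimensional normed space $X$ possesses an $(n-1)$-dimensional subspace $Y$ such that $\lambda(Y, X) < 2 - \frac{2}{n}$.
   Context: All normed spaces are real. For a subspace $Y$ of a normed space $X$, a projection from $X$ onto $Y$ is a bounded linear operator $P: X \to Y$ with $P|_Y = \mathrm{Id}_Y$; the relative projection constant $\lambda(Y,X)$ is the infimum of $\|P\|$ over all projections $P$ from $X$ onto $Y$. *)

theory Defs
  imports "HOL-Analysis.Analysis"
begin

definition is_projection_onto :: "('a::real_normed_vector \<Rightarrow> 'a) \<Rightarrow> 'a set \<Rightarrow> bool" where
  "is_projection_onto P Y \<longleftrightarrow>
     bounded_linear P \<and> (\<forall>x. P x \<in> Y) \<and> (\<forall>y\<in>Y. P y = y)"

text \<open>The ambient space \<open>X\<close> is the whole type. The infimum is taken in the extended reals, so that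
  it is \<open>\<infinity>\<close> when there is no projection onto \<open>Y\<close>; in \<open>real\<close> it would be
  an unspecified number.\<close>

definition rel_proj_const :: "'a::real_normed_vector set \<Rightarrow> ereal" where
  "rel_proj_const Y = (INF P \<in> {P. is_projection_onto P Y}. ereal (onorm P))"

end

theory Submission
  imports Defs
begin

text \<open>Let \<open>f\<close> be a nonzero functional on the \<open>n\<close>-dimensional space. The projections onto its kernel are the maps
  \<open>v \<mapsto> v - f v *\<^sub>R x\<close> with \<open>f x = 1\<close>. By Helly's theorem in the affine hyperplane \<open>f = 1\<close>, a projection
  of norm at most \<open>c \<ge> 1\<close> exists as soon as for any \<open>n\<close> unit vectors \<open>y i\<close> with heights
  \<open>a i = f (y i) > 0\<close> there is an \<open>x\<close> with \<open>norm (y i - a i *\<^sub>R x) \<le> c\<close> for all \<open>i\<close>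
  (\<open>Helly_projection\<close>). Looking for \<open>x\<close> among the nonnegative combinations of the \<open>y i\<close> and
  using the triangle inequality, one obtains Bohnenblust's value \<open>c = 2 - 2 / n\<close>, and a
  strictly smaller value unless the family is tight: all heights agree, and for each \<open>i\<close> equality holds
  in the triangle inequality for \<open>(n - 1) y i\<close> and the \<open>- y j\<close> with \<open>j \<noteq> i\<close> (\<open>common_point_or_tight\<close>). A
  compactness argument then yields a tight family for every hyperplane
  with no projection of norm below \<open>2 - 2 / n\<close> (\<open>extremal_hyperplane_tight\<close>).

  A tight family forces facets on the unit ball: for each \<open>i\<close> the norm is linear on the open cone
  spanned by \<open>y i\<close> and the \<open>- y j\<close>, with some gradient \<open>g i\<close>. For \<open>n \<ge> 3\<close> the \<open>y i\<close> are a basis, and \<open>f\<close>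
  is a multiple of the sum of the \<open>g i\<close> (\<open>tight_functional\<close>). But a unit ball has only countably many
  facets, because different gradients belong to disjoint open sets (\<open>countable_local_gradients\<close>). So at
  most countably many hyperplanes are extremal, while there are uncountably many hyperplanes.

  The argument takes place in \<open>'e \<times> real\<close> with a Euclidean space \<open>'e\<close> of dimension \<open>n - 1\<close>, and a linear
  injection \<open>T\<close> into the normed space. The functionals are \<open>v \<mapsto> (a, 1) \<bullet> v\<close>, for
  which \<open>u \<mapsto> (u, 1 - a \<bullet> u)\<close> parametrises the affine hyperplane \<open>f = 1\<close> by \<open>'e\<close>.\<close>

section \<open>Weights that balance the points against each other\<close>

lemma reciprocal_ge_tangent:
  fixes a \<mu> :: real
  assumes "a > 0" "\<mu> > 0"
  shows "1 / a \<ge> 2 / \<mu> - a / \<mu>\<^sup>2"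
    and "a \<noteq> \<mu> \<Longrightarrow> 1 / a > 2 / \<mu> - a / \<mu>\<^sup>2"
proof -
  have eq: "1 / a - (2 / \<mu> - a / \<mu>\<^sup>2) = (a - \<mu>)\<^sup>2 / (a * \<mu>\<^sup>2)"
    using assms by (simp add: field_simps power2_eq_square)
  have "(a - \<mu>)\<^sup>2 / (a * \<mu>\<^sup>2) \<ge> 0" using assms by simp
  then show "1 / a \<ge> 2 / \<mu> - a / \<mu>\<^sup>2" using eq by linarith
  assume "a \<noteq> \<mu>"
  then have "(a - \<mu>)\<^sup>2 / (a * \<mu>\<^sup>2) > 0" using assms by simp
  then show "1 / a > 2 / \<mu> - a / \<mu>\<^sup>2" using eq by linarith
qed

text \<open>The inequality of the arithmetic and harmonic means: the tangents are taken at the arithmetic mean,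
  so their sum is the harmonic bound, and one \<open>a k\<close> off the mean makes it strict.\<close>

lemma sum_mult_sum_reciprocal:
  fixes a :: "'i \<Rightarrow> real"
  assumes "finite J" "J \<noteq> {}" and pos: "\<And>i. i \<in> J \<Longrightarrow> a i > 0"
  shows "(real (card J))\<^sup>2 \<le> (\<Sum>i\<in>J. a i) * (\<Sum>i\<in>J. 1 / a i)"
    and "\<not> (\<forall>i\<in>J. \<forall>j\<in>J. a i = a j) \<Longrightarrow>
      (real (card J))\<^sup>2 < (\<Sum>i\<in>J. a i) * (\<Sum>i\<in>J. 1 / a i)"
proof -
  define m S where "m = real (card J)" and "S = (\<Sum>i\<in>J. a i)"
  have "m > 0" "S > 0"
    using assms by (auto simp: m_def S_def card_gt_0_iff intro!: sum_pos)
  define \<mu> where "\<mu> = S / m"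
  have "\<mu> > 0" using \<open>m > 0\<close> \<open>S > 0\<close> by (simp add: \<mu>_def)
  have "(\<Sum>i\<in>J. 2 / \<mu> - a i / \<mu>\<^sup>2) = m * (2 / \<mu>) - S / \<mu>\<^sup>2"
    by (simp add: sum_subtractf m_def S_def sum_divide_distrib)
  also have "\<dots> = m\<^sup>2 / S"
    using \<open>m > 0\<close> \<open>S > 0\<close> by (simp add: \<mu>_def field_simps power2_eq_square)
  finally have tangent: "(\<Sum>i\<in>J. 2 / \<mu> - a i / \<mu>\<^sup>2) = m\<^sup>2 / S" .
  have "m\<^sup>2 / S \<le> (\<Sum>i\<in>J. 1 / a i)"
    unfolding tangent[symmetric]
    by (rule sum_mono) (use reciprocal_ge_tangent(1)[OF pos \<open>\<mu> > 0\<close>] in simp)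
  then show "(real (card J))\<^sup>2 \<le> (\<Sum>i\<in>J. a i) * (\<Sum>i\<in>J. 1 / a i)"
    using \<open>S > 0\<close> by (simp add: m_def[symmetric] S_def[symmetric] field_simps)
  assume "\<not> (\<forall>i\<in>J. \<forall>j\<in>J. a i = a j)"
  then obtain k where k: "k \<in> J" "a k \<noteq> \<mu>" by metis
  have "m\<^sup>2 / S < (\<Sum>i\<in>J. 1 / a i)"
    unfolding tangent[symmetric]
  proof (rule sum_strict_mono_ex1[OF \<open>finite J\<close>])
    show "\<forall>i\<in>J. 2 / \<mu> - a i / \<mu>\<^sup>2 \<le> 1 / a i"
      using reciprocal_ge_tangent(1)[OF pos \<open>\<mu> > 0\<close>] by blast
    show "\<exists>i\<in>J. 2 / \<mu> - a i / \<mu>\<^sup>2 < 1 / a i"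
      using reciprocal_ge_tangent(2)[OF pos \<open>\<mu> > 0\<close>] k by blast
  qed
  then show "(real (card J))\<^sup>2 < (\<Sum>i\<in>J. a i) * (\<Sum>i\<in>J. 1 / a i)"
    using \<open>S > 0\<close> by (simp add: m_def[symmetric] S_def[symmetric] field_simps)
qed

text \<open>Think of unit vectors \<open>y i\<close> at heights \<open>a i\<close> over the hyperplane and of the point with
  weights \<open>w\<close>, scaled to height one. The quantity bounded here is the excess over \<open>1\<close> in the
  crude triangle estimate for \<open>y i\<close> (see \<open>norm_residual_le\<close> below). Equalising the excess over
  all \<open>i\<close> may call for negative weights at small heights, so weights
  proportional to the positive part of \<open>1 - \<theta> / a i\<close> are used, with the level \<open>\<theta>\<close> fixed by the
  intermediate value theorem. The common excess on the set of \<open>m\<close> active indices is at most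
  \<open>1 - 2 / m\<close> by the inequality of the means; hence the value \<open>1 - 2 / n\<close> could only be needed
  when all heights agree.\<close>

lemma balanced_weights:
  fixes a :: "'i \<Rightarrow> real"
  assumes "finite I" and n3: "card I \<ge> 3"
    and nonneg: "\<And>i. i \<in> I \<Longrightarrow> a i \<ge> 0"
    and ne: "\<not> (\<forall>i\<in>I. \<forall>j\<in>I. a i = a j)"
  obtains w where "\<And>i. w i \<ge> 0" "(\<Sum>i\<in>I. a i * w i) = 1"
    "\<And>i. i \<in> I \<Longrightarrow> a i * ((\<Sum>j\<in>I. w j) - 2 * w i) < 1 - 2 / real (card I)"
proof -
  define n where "n = real (card I)"
  have n: "n \<ge> 3" using n3 by (simp add: n_def)
  then have gap: "1 - 2 / n > 0" by (simp add: field_simps)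
  define A where "A = {i\<in>I. a i > 0}"
  have "finite A" "A \<subseteq> I" using \<open>finite I\<close> by (auto simp: A_def)
  have "A \<noteq> {}"
    using ne nonneg unfolding A_def by (metis (mono_tags, lifting) empty_Collect_eq le_less)
  show ?thesis
  proof (cases "card A \<le> 2")
    case True
    \<comment> \<open>With at most two positive heights no positive \<open>\<theta>\<close> gives weights of total \<open>2\<close>, but equal
      weights on them already make every excess nonpositive.\<close>
    define S where "S = (\<Sum>i\<in>A. a i)"
    have "S > 0" unfolding S_def using \<open>finite A\<close> \<open>A \<noteq> {}\<close> by (intro sum_pos) (auto simp: A_def)
    define w where "w i = (if i \<in> A then 1 / S else 0)" for i
    have W: "(\<Sum>j\<in>I. w j) = real (card A) / S"
      using \<open>finite I\<close> \<open>A \<subseteq> I\<close> by (simp add: w_def sum.If_cases Int_absorb1)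
    show ?thesis
    proof
      show "w i \<ge> 0" for i using \<open>S > 0\<close> by (simp add: w_def)
      have "(\<Sum>i\<in>I. a i * w i) = (\<Sum>i\<in>A. a i * w i)"
        by (rule sum.mono_neutral_right) (use \<open>finite I\<close> \<open>A \<subseteq> I\<close> in \<open>auto simp: w_def\<close>)
      also have "\<dots> = (\<Sum>i\<in>A. a i) / S" by (simp add: w_def sum_divide_distrib)
      finally show "(\<Sum>i\<in>I. a i * w i) = 1" using \<open>S > 0\<close> by (simp add: S_def)
      fix i assume "i \<in> I"
      have "a i * ((\<Sum>j\<in>I. w j) - 2 * w i) \<le> 0"
      proof (cases "i \<in> A")
        case iA: True
        have "(\<Sum>j\<in>I. w j) - 2 * w i = (real (card A) - 2) / S"
          using iA by (simp add: W) (simp add: w_def diff_divide_distrib)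
        also have "\<dots> \<le> 0" using True \<open>S > 0\<close> by (simp add: field_simps)
        finally show ?thesis using nonneg[OF \<open>i \<in> I\<close>] by (simp add: mult_nonneg_nonpos)
      next
        case False
        then have "a i = 0" using nonneg[OF \<open>i \<in> I\<close>] \<open>i \<in> I\<close> by (auto simp: A_def)
        then show ?thesis by simp
      qed
      then show "a i * ((\<Sum>j\<in>I. w j) - 2 * w i) < 1 - 2 / real (card I)"
        using gap by (simp add: n_def)
    qed
  next
    case False
    \<comment> \<open>The total of the weights is \<open>g \<theta>\<close> up to scaling. At \<open>g \<theta> = 2\<close> the excess of an active
      index, \<open>a i * (2 - 2 * (1 - \<theta> / a i))\<close>, is \<open>2 * \<theta>\<close> and no longer depends on \<open>i\<close>.\<close>
    define g where "g \<theta> = (\<Sum>i\<in>A. max 0 (1 - \<theta> / a i))" for \<theta>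
    define M where "M = Max (a ` A)"
    have M: "a i \<le> M" if "i \<in> A" for i
      using that \<open>finite A\<close> by (simp add: M_def)
    have "M \<ge> 0"
    proof -
      obtain i where "i \<in> A" using \<open>A \<noteq> {}\<close> by auto
      then show ?thesis using M[of i] by (auto simp: A_def)
    qed
    have "g 0 = real (card A)" by (simp add: g_def)
    then have g0: "g 0 \<ge> 3" using False by simp
    have gM: "g M = 0"
      unfolding g_def using M by (intro sum.neutral) (auto simp: A_def)
    have "\<exists>\<theta>. 0 \<le> \<theta> \<and> \<theta> \<le> M \<and> g \<theta> = 2"
    proof (rule IVT2')
      show "g M \<le> 2" "2 \<le> g 0" using g0 gM by auto
      show "continuous_on {0..M} g"
        unfolding g_def by (intro continuous_intros) (auto simp: A_def)
    qed (use \<open>M \<ge> 0\<close> in auto)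
    then obtain \<theta> where "\<theta> \<ge> 0" and g\<theta>: "g \<theta> = 2" by blast
    then have "\<theta> > 0" using g0 by (cases "\<theta> = 0") auto
    define J where "J = {i\<in>A. a i > \<theta>}"
    have "finite J" "J \<subseteq> A" "J \<subseteq> I" using \<open>finite A\<close> \<open>A \<subseteq> I\<close> by (auto simp: J_def)
    have posJ: "a i > 0" if "i \<in> J" for i using that by (auto simp: J_def A_def)
    have "g \<theta> = (\<Sum>i\<in>J. max 0 (1 - \<theta> / a i))"
      unfolding g_def
    proof (rule sum.mono_neutral_right[OF \<open>finite A\<close> \<open>J \<subseteq> A\<close>])
      show "\<forall>i\<in>A - J. max 0 (1 - \<theta> / a i) = 0"
        by (auto simp: J_def A_def max_def pos_divide_less_eq not_less)
    qed
    also have "\<dots> = (\<Sum>i\<in>J. 1 - \<theta> / a i)"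
      by (rule sum.cong) (auto simp: J_def A_def max_def pos_divide_le_eq)
    finally have level: "(\<Sum>i\<in>J. 1 - \<theta> / a i) = 2" using g\<theta> by simp
    then have "J \<noteq> {}" by auto
    define m S H where "m = real (card J)" and "S = (\<Sum>i\<in>J. a i)" and "H = (\<Sum>i\<in>J. 1 / a i)"
    have "(\<Sum>i\<in>J. 1 - \<theta> / a i) = m - \<theta> * H"
      by (simp add: sum_subtractf m_def H_def sum_distrib_left)
    then have H: "\<theta> * H = m - 2" using level by simp
    have "H > 0" unfolding H_def using \<open>finite J\<close> \<open>J \<noteq> {}\<close> posJ by (intro sum_pos) auto
    then have "m > 2" using H \<open>\<theta> > 0\<close> by (smt (verit) mult_pos_pos)
    have "m \<le> n" unfolding m_def n_def using \<open>J \<subseteq> I\<close> \<open>finite I\<close> by (simp add: card_mono)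
    define D where "D = S - m * \<theta>"
    have D_sum: "D = (\<Sum>i\<in>J. a i - \<theta>)" by (simp add: D_def S_def m_def sum_subtractf)
    have "D > 0" unfolding D_sum
      using \<open>finite J\<close> \<open>J \<noteq> {}\<close> by (intro sum_pos) (auto simp: J_def)
    have SH: "m\<^sup>2 \<le> S * H"
      unfolding m_def S_def H_def
      using sum_mult_sum_reciprocal(1)[OF \<open>finite J\<close> \<open>J \<noteq> {}\<close> posJ] .
    have SH_strict: "m\<^sup>2 < S * H" if "m = n"
    proof -
      have "J = I"
        using card_subset_eq[OF \<open>finite I\<close> \<open>J \<subseteq> I\<close>] that by (simp add: m_def n_def)
      then show ?thesis
        unfolding m_def S_def H_def
        using sum_mult_sum_reciprocal(2)[OF \<open>finite J\<close> \<open>J \<noteq> {}\<close> posJ] ne by simp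
    qed
    have D_id: "(m - 2) * D = \<theta> * (S * H - m\<^sup>2) + 2 * m * \<theta>"
    proof -
      have "(m - 2) * S = \<theta> * (S * H)" using H by (simp add: algebra_simps flip: H)
      then show ?thesis by (simp add: D_def algebra_simps power2_eq_square)
    qed
    \<comment> \<open>The claim to be reached, \<open>2 * \<theta> / D < 1 - 2 / n\<close>, cleared of denominators, times \<open>m - 2\<close>; the defect
      splits into the gap between the means and the gap between \<open>m\<close> and \<open>n\<close>.\<close>
    have "(m - 2) * ((n - 2) * D - 2 * n * \<theta>)
        = (n - 2) * \<theta> * (S * H - m\<^sup>2) + 4 * (n - m) * \<theta>"
    proof -
      have "(m - 2) * ((n - 2) * D - 2 * n * \<theta>)
          = (n - 2) * ((m - 2) * D) - (m - 2) * (2 * n * \<theta>)" by (simp add: algebra_simps)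
      then show ?thesis unfolding D_id by (simp add: algebra_simps)
    qed
    also have "\<dots> > 0"
    proof (cases "m = n")
      case True
      have "(n - 2) * \<theta> * (S * H - m\<^sup>2) > 0"
        using SH_strict[OF True] n \<open>\<theta> > 0\<close> by (intro mult_pos_pos) auto
      then show ?thesis using True by simp
    next
      case False
      have "(n - 2) * \<theta> * (S * H - m\<^sup>2) \<ge> 0"
        using SH n \<open>\<theta> > 0\<close> by (intro mult_nonneg_nonneg) auto
      moreover have "4 * (n - m) * \<theta> > 0" using False \<open>m \<le> n\<close> \<open>\<theta> > 0\<close> by simp
      ultimately show ?thesis by linarith
    qed
    finally have "(n - 2) * D - 2 * n * \<theta> > 0"
      using \<open>m > 2\<close> by (simp add: zero_less_mult_iff)
    then have small: "2 * \<theta> / D < 1 - 2 / n"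
      using \<open>D > 0\<close> n by (simp add: field_simps)
    define w where "w i = (if i \<in> J then (1 - \<theta> / a i) / D else 0)" for i
    have sum_J: "(\<Sum>i\<in>I. h i * w i) = (\<Sum>i\<in>J. h i * (1 - \<theta> / a i)) / D" for h
    proof -
      have "(\<Sum>i\<in>I. h i * w i) = (\<Sum>i\<in>J. h i * w i)"
        by (rule sum.mono_neutral_right) (use \<open>finite I\<close> \<open>J \<subseteq> I\<close> in \<open>auto simp: w_def\<close>)
      then show ?thesis by (simp add: w_def sum_divide_distrib)
    qed
    have W: "(\<Sum>j\<in>I. w j) = 2 / D" using sum_J[of "\<lambda>_. 1"] level by simp
    show ?thesis
    proof
      show "w i \<ge> 0" for i using \<open>D > 0\<close> by (auto simp: w_def J_def A_def field_simps)
      have "(\<Sum>i\<in>J. a i * (1 - \<theta> / a i)) = D"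
        unfolding D_sum by (rule sum.cong) (auto dest!: posJ simp: right_diff_distrib)
      then show "(\<Sum>i\<in>I. a i * w i) = 1" using sum_J[of a] \<open>D > 0\<close> by simp
      fix i assume "i \<in> I"
      have "a i * ((\<Sum>j\<in>I. w j) - 2 * w i) \<le> 2 * \<theta> / D"
      proof (cases "i \<in> J")
        case True
        then show ?thesis
          using posJ[of i] \<open>D > 0\<close> by (simp add: W) (simp add: w_def field_simps)
      next
        case False
        then have "a i \<le> \<theta>" using \<open>i \<in> I\<close> \<open>\<theta> > 0\<close> by (force simp: J_def A_def)
        then show ?thesis using False \<open>D > 0\<close> by (simp add: W) (simp add: w_def field_simps)
      qed
      then show "a i * ((\<Sum>j\<in>I. w j) - 2 * w i) < 1 - 2 / real (card I)"
        using small by (simp add: n_def)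
    qed
  qed
qed

text \<open>The weight at \<open>i\<close> shortens the residual and the weights at the other indices can only lengthen
  it, by their full size at worst.\<close>

lemma norm_residual_le:
  fixes y :: "'i \<Rightarrow> 'a::real_normed_vector"
  assumes "finite I" "i \<in> I" and unit: "\<And>j. j \<in> I \<Longrightarrow> norm (y j) = 1"
    and a: "\<And>j. j \<in> I \<Longrightarrow> a j \<ge> 0" and w: "\<And>j. j \<in> I \<Longrightarrow> w j \<ge> 0"
    and one: "(\<Sum>j\<in>I. a j * w j) = 1"
  shows "norm (y i - a i *\<^sub>R (\<Sum>j\<in>I. w j *\<^sub>R y j)) \<le> 1 + a i * ((\<Sum>j\<in>I. w j) - 2 * w i)"
proof -
  have "a i * w i \<le> (\<Sum>j\<in>I. a j * w j)"
    using assms by (intro member_le_sum) auto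
  then have le1: "a i * w i \<le> 1" using one by simp
  have split: "(\<Sum>j\<in>I. h j) = h i + (\<Sum>j\<in>I-{i}. h j)" for h :: "'i \<Rightarrow> 'b::comm_monoid_add"
    using \<open>finite I\<close> \<open>i \<in> I\<close> by (rule sum.remove)
  have "y i - a i *\<^sub>R (\<Sum>j\<in>I. w j *\<^sub>R y j)
      = (1 - a i * w i) *\<^sub>R y i - a i *\<^sub>R (\<Sum>j\<in>I-{i}. w j *\<^sub>R y j)"
    by (simp add: split algebra_simps)
  also have "norm \<dots> \<le> norm ((1 - a i * w i) *\<^sub>R y i) + norm (a i *\<^sub>R (\<Sum>j\<in>I-{i}. w j *\<^sub>R y j))"
    by (rule norm_triangle_ineq4)
  also have "\<dots> \<le> (1 - a i * w i) + a i * (\<Sum>j\<in>I-{i}. w j)"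
  proof (rule add_mono)
    show "norm ((1 - a i * w i) *\<^sub>R y i) \<le> 1 - a i * w i" using le1 unit \<open>i \<in> I\<close> by simp
    have "norm (\<Sum>j\<in>I-{i}. w j *\<^sub>R y j) \<le> (\<Sum>j\<in>I-{i}. w j)"
      by (rule sum_norm_le) (use unit w in auto)
    then show "norm (a i *\<^sub>R (\<Sum>j\<in>I-{i}. w j *\<^sub>R y j)) \<le> a i * (\<Sum>j\<in>I-{i}. w j)"
      using a[OF \<open>i \<in> I\<close>] by (simp add: mult_left_mono)
  qed
  also have "\<dots> = 1 + a i * ((\<Sum>j\<in>I. w j) - 2 * w i)"
    by (simp add: split algebra_simps)
  finally show ?thesis .
qed

text \<open>Bohnenblust's estimate for \<open>n\<close> unit vectors, with its equality case. Unequal heights are settled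
  by the balanced weights. For equal heights the uniform weights give at most \<open>2 - 2 / n\<close> at every
  index; if the estimate is not attained at one index \<open>k\<close>, there is room to move a little weight from
  \<open>k\<close> to all the others, which lowers their bounds strictly.\<close>

lemma common_point_or_tight:
  fixes y :: "'i \<Rightarrow> 'a::real_normed_vector"
  assumes "finite I" and n3: "card I \<ge> 3" and unit: "\<And>i. i \<in> I \<Longrightarrow> norm (y i) = 1"
    and a: "\<And>i. i \<in> I \<Longrightarrow> a i \<ge> 0" and "\<exists>i\<in>I. a i > 0"
  obtains (point) w where "(\<Sum>i\<in>I. a i * w i) = 1"
      "\<And>i. i \<in> I \<Longrightarrow> norm (y i - a i *\<^sub>R (\<Sum>j\<in>I. w j *\<^sub>R y j)) < 2 - 2 / real (card I)"
  | (tight) \<alpha> where "\<alpha> > 0" "\<And>i. i \<in> I \<Longrightarrow> a i = \<alpha>"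
      "\<And>i. i \<in> I \<Longrightarrow> norm (real (card I) *\<^sub>R y i - (\<Sum>j\<in>I. y j)) = 2 * real (card I) - 2"
proof -
  define n where "n = real (card I)"
  have n: "n \<ge> 3" using n3 by (simp add: n_def)
  consider (unequal) "\<not> (\<forall>i\<in>I. \<forall>j\<in>I. a i = a j)"
    | (slack) \<alpha> k where "\<alpha> > 0" "\<And>i. i \<in> I \<Longrightarrow> a i = \<alpha>" "k \<in> I"
        "norm (n *\<^sub>R y k - (\<Sum>j\<in>I. y j)) \<noteq> 2 * n - 2"
    | (full) \<alpha> where "\<alpha> > 0" "\<And>i. i \<in> I \<Longrightarrow> a i = \<alpha>"
        "\<And>i. i \<in> I \<Longrightarrow> norm (n *\<^sub>R y i - (\<Sum>j\<in>I. y j)) = 2 * n - 2"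
  proof (cases "\<exists>i\<in>I. \<exists>j\<in>I. a i \<noteq> a j")
    case False
    obtain i0 where i0: "i0 \<in> I" "a i0 > 0" using \<open>\<exists>i\<in>I. a i > 0\<close> by blast
    with False have eq: "\<And>i. i \<in> I \<Longrightarrow> a i = a i0" by blast
    show ?thesis
    proof (cases "\<forall>i\<in>I. norm (n *\<^sub>R y i - (\<Sum>j\<in>I. y j)) = 2 * n - 2")
      case True
      then show ?thesis using full[OF i0(2) eq] by blast
    next
      case False
      then show ?thesis using slack[OF i0(2) eq] by blast
    qed
  next
    case True
    then have "\<not> (\<forall>i\<in>I. \<forall>j\<in>I. a i = a j)" by blast
    then show ?thesis by (rule unequal)
  qed
  then show ?thesis
  proof cases
    case unequal
    obtain w where w: "\<And>i. w i \<ge> 0" "(\<Sum>i\<in>I. a i * w i) = 1"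
      "\<And>i. i \<in> I \<Longrightarrow> a i * ((\<Sum>j\<in>I. w j) - 2 * w i) < 1 - 2 / real (card I)"
      by (rule balanced_weights[OF \<open>finite I\<close> n3 a unequal]) (assumption, rule that)
    show ?thesis
    proof (rule point)
      fix i assume "i \<in> I"
      show "norm (y i - a i *\<^sub>R (\<Sum>j\<in>I. w j *\<^sub>R y j)) < 2 - 2 / real (card I)"
        using norm_residual_le[OF \<open>finite I\<close> \<open>i \<in> I\<close> unit a _ w(2)] w(1) w(3)[OF \<open>i \<in> I\<close>]
        by (fastforce simp: n_def)
    qed (rule w(2))
  next
    case full
    then show ?thesis using tight unfolding n_def by blast
  next
    case slack
    define Y where "Y = (\<Sum>j\<in>I. y j)"
    define v where "v = Y - n *\<^sub>R y k"
    \<comment> \<open>Every index gains \<open>\<delta>\<close> and \<open>k\<close> pays \<open>n * \<delta>\<close>, so the total weight stays \<open>1 / \<alpha>\<close>.\<close>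
    define w where "w \<delta> i = 1 / (n * \<alpha>) + \<delta> - (if i = k then n * \<delta> else 0)" for \<delta> i
    have W: "(\<Sum>j\<in>I. w \<delta> j) = 1 / \<alpha>" for \<delta>
      using \<open>finite I\<close> \<open>k \<in> I\<close> n
      by (simp add: w_def sum_subtractf sum.distrib n_def[symmetric] distrib_left)
    then have one: "(\<Sum>j\<in>I. a j * w \<delta> j) = 1" for \<delta>
      using slack(1,2) by (simp flip: sum_distrib_left)
    have point_eq: "(\<Sum>j\<in>I. w \<delta> j *\<^sub>R y j) = (1 / (n * \<alpha>)) *\<^sub>R Y + \<delta> *\<^sub>R v" for \<delta>
    proof -
      have "(\<Sum>j\<in>I. w \<delta> j *\<^sub>R y j)
          = (\<Sum>j\<in>I. (1 / (n * \<alpha>) + \<delta>) *\<^sub>R y j - (if j = k then (n * \<delta>) *\<^sub>R y j else 0))"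
        by (rule sum.cong) (auto simp: w_def algebra_simps)
      also have "\<dots> = (1 / (n * \<alpha>) + \<delta>) *\<^sub>R Y - (n * \<delta>) *\<^sub>R y k"
        using \<open>finite I\<close> \<open>k \<in> I\<close> by (simp add: sum_subtractf Y_def scaleR_sum_right)
      finally show ?thesis by (simp add: v_def algebra_simps)
    qed
    have centre: "norm (y k - (1 / n) *\<^sub>R Y) < 2 - 2 / n"
    proof -
      have "norm (y k - (1 / n) *\<^sub>R Y) \<le> 2 - 2 / n"
        using norm_residual_le[of I k y "\<lambda>_. 1" "\<lambda>_. 1 / n"] \<open>finite I\<close> \<open>k \<in> I\<close> unit n
        by (simp add: n_def[symmetric] Y_def scaleR_sum_right)
      moreover have "n *\<^sub>R (y k - (1 / n) *\<^sub>R Y) = n *\<^sub>R y k - Y"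
        using n by (simp add: algebra_simps)
      then have "n * norm (y k - (1 / n) *\<^sub>R Y) \<noteq> n * (2 - 2 / n)"
        using slack(4) n by (metis Y_def abs_of_nonneg norm_scaleR order_trans right_diff_distrib
            zero_le_numeral mult.commute nonzero_eq_divide_eq not_numeral_le_zero)
      ultimately show ?thesis by force
    qed
    have "((\<lambda>\<delta>. norm (y k - \<alpha> *\<^sub>R ((1 / (n * \<alpha>)) *\<^sub>R Y + \<delta> *\<^sub>R v)))
        \<longlongrightarrow> norm (y k - \<alpha> *\<^sub>R ((1 / (n * \<alpha>)) *\<^sub>R Y + 0 *\<^sub>R v))) (at_right 0)"
      by (intro tendsto_intros)
    moreover have "norm (y k - \<alpha> *\<^sub>R ((1 / (n * \<alpha>)) *\<^sub>R Y + 0 *\<^sub>R v)) < 2 - 2 / n"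
      using centre \<open>\<alpha> > 0\<close> by simp
    ultimately have ev1: "\<forall>\<^sub>F \<delta> in at_right 0.
        norm (y k - \<alpha> *\<^sub>R ((1 / (n * \<alpha>)) *\<^sub>R Y + \<delta> *\<^sub>R v)) < 2 - 2 / n"
      by (rule order_tendstoD)
    have ev2: "\<forall>\<^sub>F \<delta> in at_right 0. \<delta> < 1 / (n * \<alpha>) / n"
      using eventually_at_right_real[of 0 "1 / (n * \<alpha>) / n"] n \<open>\<alpha> > 0\<close>
      by (auto elim!: eventually_mono)
    obtain \<delta> where \<delta>: "\<delta> > 0" "\<delta> < 1 / (n * \<alpha>) / n"
      "norm (y k - \<alpha> *\<^sub>R (\<Sum>j\<in>I. w \<delta> j *\<^sub>R y j)) < 2 - 2 / n"
      using eventually_happens'[OF trivial_limit_at_right_real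
          eventually_conj[OF eventually_conj[OF ev1 ev2] eventually_at_right_less]]
      by (auto simp: point_eq)
    have "n * \<delta> < n * (1 / (n * \<alpha>) / n)"
      using \<delta>(2) n by (intro mult_strict_left_mono) auto
    then have "n * \<delta> < 1 / (n * \<alpha>)" using n by simp
    then have wpos: "w \<delta> j \<ge> 0" for j using \<delta>(1) n \<open>\<alpha> > 0\<close> by (simp add: w_def)
    show ?thesis
    proof (rule point)
      show "(\<Sum>i\<in>I. a i * w \<delta> i) = 1" by (rule one)
      fix i assume "i \<in> I"
      show "norm (y i - a i *\<^sub>R (\<Sum>j\<in>I. w \<delta> j *\<^sub>R y j)) < 2 - 2 / real (card I)"
      proof (cases "i = k")
        case True
        then show ?thesis using \<delta>(3) slack(2) \<open>k \<in> I\<close> by (simp add: n_def)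
      next
        case False
        have "norm (y i - a i *\<^sub>R (\<Sum>j\<in>I. w \<delta> j *\<^sub>R y j))
            \<le> 1 + a i * ((\<Sum>j\<in>I. w \<delta> j) - 2 * w \<delta> i)"
          by (rule norm_residual_le) (use \<open>finite I\<close> \<open>i \<in> I\<close> unit a wpos one in auto)
        also have "\<dots> = 2 - 2 / n - 2 * \<alpha> * \<delta>"
          unfolding W using False slack(1,2) \<open>i \<in> I\<close> n by (simp add: w_def field_simps)
        also have "\<dots> < 2 - 2 / n" using \<open>\<alpha> > 0\<close> \<delta>(1) by simp
        finally show ?thesis by (simp add: n_def)
      qed
    qed
  qed
qed

section \<open>Tight families determine the hyperplane\<close>

text \<open>Equality in the triangle inequality spreads to the whole cone: for \<open>M\<close> above all
  coefficients, \<open>M\<close> times the sum is the given combination plus another nonnegative one, and strict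
  inequality for the first would contradict equality for the total.\<close>

lemma norm_sum_additive_cone:
  fixes v :: "'i \<Rightarrow> 'a::real_normed_vector"
  assumes "finite I" and additive: "norm (\<Sum>i\<in>I. v i) = (\<Sum>i\<in>I. norm (v i))"
    and c: "\<And>i. i \<in> I \<Longrightarrow> c i \<ge> 0"
  shows "norm (\<Sum>i\<in>I. c i *\<^sub>R v i) = (\<Sum>i\<in>I. c i * norm (v i))"
proof (rule antisym)
  show "norm (\<Sum>i\<in>I. c i *\<^sub>R v i) \<le> (\<Sum>i\<in>I. c i * norm (v i))"
    by (rule sum_norm_le) (use c in auto)
  define M where "M = (\<Sum>i\<in>I. c i)"
  have M: "c i \<le> M" if "i \<in> I" for i
    unfolding M_def using \<open>finite I\<close> that c by (intro member_le_sum) auto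
  have "M \<ge> 0" unfolding M_def using c by (rule sum_nonneg)
  have "M * (\<Sum>i\<in>I. norm (v i)) = norm (M *\<^sub>R (\<Sum>i\<in>I. v i))"
    using additive \<open>M \<ge> 0\<close> by simp
  also have "M *\<^sub>R (\<Sum>i\<in>I. v i) = (\<Sum>i\<in>I. c i *\<^sub>R v i) + (\<Sum>i\<in>I. (M - c i) *\<^sub>R v i)"
    by (simp add: scaleR_sum_right scaleR_diff_left sum_subtractf)
  also have "norm \<dots> \<le> norm (\<Sum>i\<in>I. c i *\<^sub>R v i) + (\<Sum>i\<in>I. (M - c i) * norm (v i))"
    by (intro order_trans[OF norm_triangle_ineq] add_left_mono sum_norm_le) (use M in auto)
  also have "(\<Sum>i\<in>I. (M - c i) * norm (v i))
      = M * (\<Sum>i\<in>I. norm (v i)) - (\<Sum>i\<in>I. c i * norm (v i))"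
    by (simp add: left_diff_distrib sum_subtractf sum_distrib_left)
  finally show "(\<Sum>i\<in>I. c i * norm (v i)) \<le> norm (\<Sum>i\<in>I. c i *\<^sub>R v i)" by simp
qed

text \<open>The linear functionals that coincide with \<open>N\<close> on some nonempty open set. For a norm on a
  finite-dimensional space these are the functionals whose hyperplanes carry the facets of the unit ball.\<close>

definition local_gradients :: "('b::real_normed_vector \<Rightarrow> real) \<Rightarrow> ('b \<Rightarrow> real) set" where
  "local_gradients N = {g. linear g \<and> (\<exists>U. open U \<and> U \<noteq> {} \<and> (\<forall>v\<in>U. N v = g v))}"

lemma linear_eq_if_eq_on_open:
  fixes g h :: "'b::real_normed_vector \<Rightarrow> real"
  assumes "linear g" "linear h" "open U" "d \<in> U" and eq: "\<And>v. v \<in> U \<Longrightarrow> g v = h v"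
  shows "g = h"
proof
  fix v
  have "((\<lambda>t. d + t *\<^sub>R v) \<longlongrightarrow> d + 0 *\<^sub>R v) (at_right 0)" by (intro tendsto_intros)
  then have "\<forall>\<^sub>F t in at_right (0::real). d + t *\<^sub>R v \<in> U"
    using \<open>open U\<close> \<open>d \<in> U\<close> by (intro topological_tendstoD) auto
  then have "\<forall>\<^sub>F t in at_right (0::real). d + t *\<^sub>R v \<in> U \<and> 0 < t"
    using eventually_at_right_less by (rule eventually_conj)
  then obtain t :: real where t: "d + t *\<^sub>R v \<in> U" "t > 0"
    using eventually_happens'[OF trivial_limit_at_right_real] by blast
  have "g d + t * g v = h d + t * h v"
    using eq[OF t(1)] assms(1,2) by (simp add: linear_add linear_scale)
  then show "g v = h v" using eq[OF \<open>d \<in> U\<close>] t(2) by simp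
qed

text \<open>A point of the open set where \<open>g\<close> and \<open>N\<close> agree determines \<open>g\<close>, and this point can be chosen in a
  countable dense set.\<close>

lemma countable_local_gradients:
  fixes N :: "'b::euclidean_space \<Rightarrow> real"
  shows "countable (local_gradients N)"
proof -
  obtain D :: "'b set" where D: "countable D"
    "\<And>X. open X \<Longrightarrow> X \<noteq> {} \<Longrightarrow> \<exists>d\<in>D. d \<in> X"
    by (rule countable_dense_setE) (rule that)
  have "\<forall>g\<in>local_gradients N. \<exists>d\<in>D. \<exists>U. open U \<and> d \<in> U \<and> (\<forall>v\<in>U. N v = g v)"
    unfolding local_gradients_def using D(2) by blast
  then obtain p where p: "\<And>g. g \<in> local_gradients N \<Longrightarrow> p g \<in> D"
    "\<And>g. g \<in> local_gradients N \<Longrightarrow> \<exists>U. open U \<and> p g \<in> U \<and> (\<forall>v\<in>U. N v = g v)"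
    by metis
  have "inj_on p (local_gradients N)"
  proof (rule inj_onI)
    fix g h assume g: "g \<in> local_gradients N" and h: "h \<in> local_gradients N" and "p g = p h"
    obtain U where U: "open U" "p g \<in> U" "\<forall>v\<in>U. N v = g v" using p(2)[OF g] by blast
    obtain V where V: "open V" "p h \<in> V" "\<forall>v\<in>V. N v = h v" using p(2)[OF h] by blast
    have "open (U \<inter> V)" using U(1) V(1) by (rule open_Int)
    moreover have "p g \<in> U \<inter> V" using U V \<open>p g = p h\<close> by simp
    moreover have "g v = h v" if "v \<in> U \<inter> V" for v using that U(3) V(3) by (metis IntD1 IntD2)
    ultimately show "g = h"
      using linear_eq_if_eq_on_open[of g h "U \<inter> V" "p g"] g h by (auto simp: local_gradients_def)
  qed
  moreover have "countable (p ` local_gradients N)"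
    by (rule countable_subset[OF _ D(1)]) (use p(1) in auto)
  ultimately show ?thesis using countable_image_inj_on by blast
qed

text \<open>For each \<open>i\<close> the tightness condition is equality in the triangle inequality for the \<open>n\<close> vectors
  \<open>(n - 1) y i\<close> and \<open>- y j\<close> with \<open>j \<noteq> i\<close>, so the norm is linear on the cone that \<open>y i\<close> and the
  \<open>- y j\<close> span. Comparing these linear formulas shows that the \<open>y j\<close> form a basis (here
  \<open>n \<noteq> 2\<close> enters: the sign matrix \<open>\<sigma>\<close> has eigenvalues \<open>2\<close> and \<open>2 - n\<close>). So every cone has interior
  points and its formula is a local gradient \<open>g i\<close>, with \<open>g i (y j) = \<sigma> i j\<close>. The sum of the
  \<open>g i\<close> takes the value \<open>2 - n\<close> at each \<open>y j\<close>, where \<open>f\<close> takes the value \<open>\<alpha>\<close>.\<close>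

lemma tight_functional:
  fixes T :: "'b::euclidean_space \<Rightarrow> 'a::real_normed_vector" and y :: "'t::finite \<Rightarrow> 'b"
  assumes "linear T" and dim: "CARD('t) = DIM('b)" and n3: "CARD('t) \<ge> 3"
    and unit: "\<And>i. norm (T (y i)) = 1"
    and tight: "\<And>i. norm (T (real CARD('t) *\<^sub>R y i - (\<Sum>j\<in>UNIV. y j))) = 2 * real CARD('t) - 2"
    and "linear f" and f: "\<And>i. f (y i) = \<alpha>"
  shows "\<exists>g :: 't \<Rightarrow> 'b \<Rightarrow> real. (\<forall>i. g i \<in> local_gradients (\<lambda>v. norm (T v))) \<and>
      (\<forall>v. \<alpha> * (\<Sum>i\<in>UNIV. g i v) = (2 - real CARD('t)) * f v)"
proof -
  interpret T: linear T by fact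
  interpret f: linear f by fact
  define n where "n = real CARD('t)"
  have n: "n \<ge> 3" using n3 by (simp add: n_def)
  define \<sigma> :: "'t \<Rightarrow> 't \<Rightarrow> real" where "\<sigma> i j = (if j = i then 1 else -1)" for i j
  have \<sigma>2: "\<sigma> i j * \<sigma> i j = 1" for i j by (simp add: \<sigma>_def)
  have \<sigma>_sum: "(\<Sum>j\<in>UNIV. \<sigma> i j * b j) = 2 * b i - (\<Sum>j\<in>UNIV. b j)" for i and b :: "'t \<Rightarrow> real"
  proof -
    have "(\<Sum>j\<in>UNIV. \<sigma> i j * b j) = (\<Sum>j\<in>UNIV. (if j = i then 2 * b j else 0) - b j)"
      by (rule sum.cong) (auto simp: \<sigma>_def)
    then show ?thesis by (simp add: sum_subtractf)
  qed
  define L :: "real^'t \<Rightarrow> 'b" where "L c = (\<Sum>j\<in>UNIV. c $ j *\<^sub>R y j)" for c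
  have "linear L"
    unfolding L_def by (rule linearI) (simp_all add: scaleR_left_distrib sum.distrib scaleR_sum_right)
  then interpret L: linear L .
  have cone: "norm (T (L c)) = (\<Sum>j\<in>UNIV. \<sigma> i j * c $ j)" if "\<And>j. \<sigma> i j * c $ j \<ge> 0" for i c
  proof -
    define p where "p j = (if j = i then n - 1 else 1)" for j
    have p: "p j > 0" for j using n by (simp add: p_def)
    define v where "v j = (p j * \<sigma> i j) *\<^sub>R T (y j)" for j
    have norm_v: "norm (v j) = p j" for j
      using p[of j] by (auto simp: v_def unit \<sigma>_def)
    have sum_p: "(\<Sum>j\<in>UNIV. p j) = 2 * n - 2"
    proof -
      have "(\<Sum>j\<in>UNIV. p j) = (\<Sum>j\<in>UNIV. 1 + (if j = i then n - 2 else 0))"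
        by (rule sum.cong) (auto simp: p_def)
      then show ?thesis by (simp add: sum.distrib n_def)
    qed
    have "(\<Sum>j\<in>UNIV. v j) = (\<Sum>j\<in>UNIV. (if j = i then n *\<^sub>R T (y j) else 0) - T (y j))"
      by (rule sum.cong) (auto simp: v_def p_def \<sigma>_def algebra_simps)
    also have "\<dots> = T (n *\<^sub>R y i - (\<Sum>j\<in>UNIV. y j))"
      by (simp add: sum_subtractf T.diff T.scale T.sum)
    finally have "norm (\<Sum>j\<in>UNIV. v j) = (\<Sum>j\<in>UNIV. norm (v j))"
      using tight[of i] by (simp add: norm_v sum_p n_def[symmetric])
    then have "norm (\<Sum>j\<in>UNIV. (\<sigma> i j * c $ j / p j) *\<^sub>R v j) = (\<Sum>j\<in>UNIV. (\<sigma> i j * c $ j / p j) * norm (v j))"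
      using norm_sum_additive_cone[OF finite, of v UNIV "\<lambda>j. \<sigma> i j * c $ j / p j"] that p
      by (simp add: less_imp_le)
    moreover have "(\<sigma> i j * c $ j / p j) *\<^sub>R v j = c $ j *\<^sub>R T (y j)" for j
      using p[of j] \<sigma>2[of i j] by (simp add: v_def)
    moreover have "(\<sigma> i j * c $ j / p j) * norm (v j) = \<sigma> i j * c $ j" for j
      using p[of j] by (simp add: norm_v)
    ultimately have "norm (\<Sum>j\<in>UNIV. c $ j *\<^sub>R T (y j)) = (\<Sum>j\<in>UNIV. \<sigma> i j * c $ j)" by simp
    then show ?thesis by (simp only: L_def T.sum T.scale)
  qed
  have "inj L"
  proof (rule linear_injective_0[OF \<open>linear L\<close>, THEN iffD2], intro allI impI)
    fix b assume "L b = 0"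
    define M where "M = (\<Sum>j\<in>UNIV. \<bar>b $ j\<bar>)"
    have M: "\<bar>b $ j\<bar> \<le> M" for j unfolding M_def by (rule member_le_sum) auto
    have "2 * b $ i = (\<Sum>j\<in>UNIV. b $ j)" for i
    proof -
      \<comment> \<open>A point far enough inside the closed cone that adding \<open>b\<close> does not leave it. The vector \<open>L b = 0\<close> does not
        change the norm, while the linear formula changes by \<open>2 * b $ i - (\<Sum>j\<in>UNIV. b $ j)\<close>.\<close>
      define s :: "real^'t" where "s = (\<chi> j. M * \<sigma> i j)"
      have s: "\<sigma> i j * s $ j = M" for j using \<sigma>2[of i j] by (simp add: s_def algebra_simps)
      have "M \<ge> 0" using M[of i] by linarith
      have "\<sigma> i j * (s + b) $ j \<ge> 0" for j
        using M[of j] s[of j] by (auto simp: distrib_left \<sigma>_def split: if_splits)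
      then have "norm (T (L (s + b))) = (\<Sum>j\<in>UNIV. \<sigma> i j * (s + b) $ j)" by (rule cone)
      moreover have "norm (T (L s)) = (\<Sum>j\<in>UNIV. \<sigma> i j * s $ j)"
        by (rule cone) (simp add: s \<open>M \<ge> 0\<close>)
      moreover have "L (s + b) = L s" using \<open>L b = 0\<close> by (simp add: L.add)
      ultimately have "(\<Sum>j\<in>UNIV. \<sigma> i j * b $ j) = 0"
        by (simp add: distrib_left sum.distrib)
      then show ?thesis by (simp add: \<sigma>_sum)
    qed
    note b = this
    have "(\<Sum>i\<in>UNIV. 2 * b $ i) = (\<Sum>i\<in>(UNIV::'t set). \<Sum>j\<in>UNIV. b $ j)"
      by (rule sum.cong) (simp_all add: b)
    then have "2 * (\<Sum>j\<in>UNIV. b $ j) = n * (\<Sum>j\<in>UNIV. b $ j)"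
      by (simp add: n_def flip: sum_distrib_left)
    then have "(\<Sum>j\<in>UNIV. b $ j) = 0" using n by simp
    then show "b = 0" using b by (simp add: vec_eq_iff)
  qed
  have "surj L"
  proof -
    have "dim (range L) = DIM('b)"
      using dim_image_eq[OF \<open>linear L\<close>, of UNIV] \<open>inj L\<close> dim by simp
    then have "span (range L) = UNIV" by (simp add: dim_eq_full)
    then show ?thesis using \<open>linear L\<close> by (metis linear_span_image span_UNIV)
  qed
  define K where "K = inv L"
  have LK: "L (K v) = v" for v using \<open>surj L\<close> by (simp add: K_def surj_f_inv_f)
  have KL: "K (L c) = c" for c using \<open>inj L\<close> by (simp add: K_def)
  have K_add: "K (u + v) = K u + K v" for u v by (metis KL L.add LK)
  have K_scale: "K (r *\<^sub>R v) = r *\<^sub>R K v" for r v by (metis KL L.scale LK)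
  define g where "g i v = (\<Sum>j\<in>UNIV. \<sigma> i j * K v $ j)" for i v
  have "g i \<in> local_gradients (\<lambda>v. norm (T v))" for i
    unfolding local_gradients_def
  proof (intro CollectI conjI exI ballI)
    show "linear (g i)"
      by (rule linearI)
        (simp_all add: g_def K_add K_scale distrib_left sum.distrib sum_distrib_left mult.left_commute)
    have "{c :: real^'t. \<forall>j. \<sigma> i j * c $ j > 0} = (\<Inter>j. {c. \<sigma> i j * c $ j > 0})" by auto
    also have "open \<dots>"
      by (intro open_INT finite ballI open_Collect_less continuous_intros)
    finally show "open (L ` {c. \<forall>j. \<sigma> i j * c $ j > 0})"
      using \<open>linear L\<close> \<open>surj L\<close> by (rule open_surjective_linear_image)
    have "(\<chi> j. \<sigma> i j) \<in> {c. \<forall>j. \<sigma> i j * c $ j > 0}" by (simp add: \<sigma>2)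
    then show "L ` {c. \<forall>j. \<sigma> i j * c $ j > 0} \<noteq> {}" by blast
    fix v assume "v \<in> L ` {c. \<forall>j. \<sigma> i j * c $ j > 0}"
    then obtain c where "v = L c" "\<And>j. \<sigma> i j * c $ j > 0" by blast
    then show "norm (T v) = g i v" using cone[of i c] by (simp add: g_def KL less_imp_le)
  qed
  moreover have "\<alpha> * (\<Sum>i\<in>UNIV. g i v) = (2 - real CARD('t)) * f v" for v
  proof -
    have "(\<Sum>i\<in>UNIV. g i v) = (2 - n) * (\<Sum>j\<in>UNIV. K v $ j)"
      by (simp add: g_def \<sigma>_sum sum_subtractf n_def left_diff_distrib flip: sum_distrib_left)
    moreover have "f v = \<alpha> * (\<Sum>j\<in>UNIV. K v $ j)"
    proof -
      have "f v = f (L (K v))" by (simp add: LK)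
      then show ?thesis by (simp add: L_def f.sum f.scale f sum_distrib_left mult.commute)
    qed
    ultimately show ?thesis by (simp add: n_def)
  qed
  ultimately have "(\<forall>i. g i \<in> local_gradients (\<lambda>v. norm (T v))) \<and>
      (\<forall>v. \<alpha> * (\<Sum>i\<in>UNIV. g i v) = (2 - real CARD('t)) * f v)" by simp
  then show ?thesis by (rule exI[of _ g])
qed

section \<open>Helly's theorem and extremal hyperplanes\<close>

text \<open>Helly's theorem for a possibly infinite family of compact convex sets, in the form in which the
  sets to be tested are listed by a type with one element more than the dimension; repetitions in
  the list take care of smaller subfamilies.\<close>

lemma Helly_indexed:
  fixes K :: "'v \<Rightarrow> 'e::euclidean_space set"
  assumes dim: "CARD('t::finite) = DIM('e) + 1"
    and convex: "\<And>v. v \<in> S \<Longrightarrow> convex (K v)" and compact: "\<And>v. v \<in> S \<Longrightarrow> compact (K v)"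
    and meet: "\<And>y :: 't \<Rightarrow> 'v. (\<And>i. y i \<in> S) \<Longrightarrow> (\<Inter>i. K (y i)) \<noteq> {}"
  shows "(\<Inter>v\<in>S. K v) \<noteq> {}"
proof (cases "S = {}")
  case False
  then obtain v0 where "v0 \<in> S" by blast
  have small: "(\<Inter>v\<in>Q. K v) \<noteq> {}" if Q: "Q \<subseteq> S" "finite Q" "card Q \<le> CARD('t)" for Q
  proof (cases "Q = {}")
    case False
    then obtain q where "q \<in> Q" by blast
    obtain h :: "'v \<Rightarrow> 't" where h: "inj_on h Q"
      using card_le_inj[of Q "UNIV :: 't set"] Q by auto
    define y where "y i = (if i \<in> h ` Q then inv_into Q h i else q)" for i
    have "y i \<in> Q" for i using \<open>q \<in> Q\<close> by (auto simp: y_def inv_into_into)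
    then have "(\<Inter>i. K (y i)) \<noteq> {}" using Q(1) by (intro meet) blast
    moreover have "v \<in> range y" if "v \<in> Q" for v
      using that h by (intro image_eqI[of _ _ "h v"]) (auto simp: y_def)
    ultimately show ?thesis by blast
  qed simp
  have fin: "(\<Inter>v\<in>Q. K v) \<noteq> {}" if Q: "Q \<subseteq> S" "finite Q" for Q
  proof (cases "card (K ` Q) \<ge> DIM('e) + 1")
    case True
    show ?thesis
    proof (rule Helly[OF True])
      show "\<forall>s\<in>K ` Q. convex s" using convex Q(1) by blast
      fix t assume t: "t \<subseteq> K ` Q" "card t = DIM('e) + 1"
      then obtain Q' where Q': "Q' \<subseteq> Q" "inj_on K Q'" "t = K ` Q'"
        using subset_image_inj[of t K Q] by blast
      have "card Q' \<le> CARD('t)" using t(2) dim Q'(3) card_image[OF Q'(2)] by simp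
      then have "(\<Inter>v\<in>Q'. K v) \<noteq> {}"
        by (rule small[OF subset_trans[OF Q'(1) Q(1)] finite_subset[OF Q'(1) Q(2)]])
      then show "\<Inter>t \<noteq> {}" using Q'(3) by simp
    qed
  next
    case False
    obtain Q' where Q': "Q' \<subseteq> Q" "inj_on K Q'" "K ` Q = K ` Q'"
      using subset_image_inj[of "K ` Q" K Q, THEN iffD1, OF subset_refl] by (elim exE conjE) (rule that)
    have "card Q' \<le> CARD('t)" using False dim Q'(3) card_image[OF Q'(2)] by simp
    then have "(\<Inter>v\<in>Q'. K v) \<noteq> {}"
      by (rule small[OF subset_trans[OF Q'(1) Q(1)] finite_subset[OF Q'(1) Q(2)]])
    then show ?thesis using Q'(3) by simp
  qed
  have "K v0 \<inter> (\<Inter>v\<in>S. K v) \<noteq> {}"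
  proof (rule compact_imp_fip_image)
    show "compact (K v0)" using compact \<open>v0 \<in> S\<close> .
    show "closed (K v)" if "v \<in> S" for v using compact[OF that] by (rule compact_imp_closed)
    fix Q assume "finite Q" "Q \<subseteq> S"
    then have "(\<Inter>v\<in>insert v0 Q. K v) \<noteq> {}" using \<open>v0 \<in> S\<close> by (intro fin) auto
    then show "K v0 \<inter> (\<Inter>v\<in>Q. K v) \<noteq> {}" by simp
  qed
  then show ?thesis by blast
qed simp

text \<open>The image space carries no Euclidean structure, so the lower bound comes from the minimum of
  \<open>norm (T v)\<close> on the compact unit sphere.\<close>

lemma linear_inj_bounded_below:
  fixes T :: "'b::euclidean_space \<Rightarrow> 'a::real_normed_vector"
  assumes "linear T" "inj T"
  obtains B where "B > 0" "\<And>v. B * norm v \<le> norm (T v)"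
proof -
  interpret T: linear T by fact
  have "continuous_on (sphere 0 1) (\<lambda>v. norm (T v))"
    using linear_continuous_on[OF linear_linear[THEN iffD2, OF \<open>linear T\<close>]]
    by (intro continuous_on_norm)
  moreover have "sphere (0::'b) 1 \<noteq> {}" by simp
  ultimately obtain e :: 'b where e: "e \<in> sphere 0 1" "\<And>v. v \<in> sphere 0 1 \<Longrightarrow> norm (T e) \<le> norm (T v)"
    using continuous_attains_inf[OF compact_sphere] by blast
  have "e \<noteq> 0" using e(1) by auto
  then have "T e \<noteq> 0" using linear_injective_0[OF \<open>linear T\<close>] \<open>inj T\<close> by blast
  show thesis
  proof
    show "norm (T e) > 0" using \<open>T e \<noteq> 0\<close> by simp
    fix v
    show "norm (T e) * norm v \<le> norm (T v)"
    proof (cases "v = 0")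
      case False
      have "norm (T e) \<le> norm (T (v /\<^sub>R norm v))" by (rule e(2)) (use False in simp)
      also have "\<dots> = norm (T v) / norm v" by (simp add: T.scale divide_inverse mult.commute)
      finally show ?thesis using False by (simp add: pos_le_divide_eq)
    qed simp
  qed
qed

text \<open>The projections along \<open>x\<close> onto the kernel of \<open>f\<close> correspond to the points \<open>x\<close> of the affine
  hyperplane \<open>f = 1\<close>, whose dimension is that of \<open>'e\<close>. Having norm at most \<open>c\<close> is one condition for each
  unit vector \<open>v\<close> with \<open>f v > 0\<close> (those with \<open>f v = 0\<close> only ask for \<open>c \<ge> 1\<close>), namely that \<open>x\<close> lies in the
  ball around \<open>v / f v\<close> of radius \<open>c / f v\<close>. These balls are convex and compact, so Helly's theorem
  reduces the search to as many vectors as the whole space has dimensions.\<close>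

lemma Helly_projection:
  fixes T :: "'e::euclidean_space \<times> real \<Rightarrow> 'a::real_normed_vector" and a :: 'e
  assumes "linear T" "inj T" and dim: "CARD('t::finite) = DIM('e) + 1" and "c \<ge> 1"
  defines "f \<equiv> \<lambda>v. (a, 1) \<bullet> v"
  assumes meet: "\<And>y :: 't \<Rightarrow> 'e \<times> real. (\<And>i. norm (T (y i)) = 1 \<and> f (y i) > 0) \<Longrightarrow>
      \<exists>x. f x = 1 \<and> (\<forall>i. norm (T (y i - f (y i) *\<^sub>R x)) \<le> c)"
  shows "\<exists>x. f x = 1 \<and> (\<forall>v. norm (T (v - f v *\<^sub>R x)) \<le> c * norm (T v))"
proof -
  interpret T: linear T by fact
  have f: "f v = a \<bullet> fst v + snd v" for v by (simp add: f_def inner_prod_def)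
  obtain B where B: "B > 0" "\<And>v. B * norm v \<le> norm (T v)"
    by (rule linear_inj_bounded_below[OF assms(1,2)]) (rule that)
  define \<psi> where "\<psi> u = (u, 1 - a \<bullet> u)" for u
  have f\<psi>: "f (\<psi> u) = 1" for u by (simp add: f \<psi>_def)
  have \<psi>: "x = \<psi> (fst x)" if "f x = 1" for x using that by (simp add: f \<psi>_def prod_eq_iff)
  define L where "L u = T (u, - (a \<bullet> u))" for u
  have "linear L"
    unfolding L_def
    by (rule linearI) (simp_all add: inner_add_right flip: T.add T.scale)
  then interpret L: linear L .
  have L_below: "B * norm u \<le> norm (L u)" for u
  proof -
    have "B * norm u \<le> B * norm (u, - (a \<bullet> u))"
      using B(1) norm_fst_le[of u "- (a \<bullet> u)"] by simp
    also have "\<dots> \<le> norm (L u)" unfolding L_def by (rule B(2))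
    finally show ?thesis .
  qed
  define K where "K v = {u. norm (T (v - f v *\<^sub>R \<psi> u)) \<le> c}" for v
  have K_vimage: "K v = (\<lambda>u. f v *\<^sub>R L u) -` cball (T (v - f v *\<^sub>R (0, 1))) c" for v
  proof -
    have "T (v - f v *\<^sub>R \<psi> u) = T (v - f v *\<^sub>R (0, 1)) - f v *\<^sub>R L u" for u
    proof -
      have "v - f v *\<^sub>R \<psi> u = (v - f v *\<^sub>R (0, 1)) - f v *\<^sub>R (u, - (a \<bullet> u))"
        by (simp add: \<psi>_def prod_eq_iff algebra_simps)
      then have "T (v - f v *\<^sub>R \<psi> u) = T ((v - f v *\<^sub>R (0, 1)) - f v *\<^sub>R (u, - (a \<bullet> u)))"
        by (rule arg_cong)
      also have "\<dots> = T (v - f v *\<^sub>R (0, 1)) - f v *\<^sub>R L u"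
        by (simp only: L_def T.diff T.scale)
      finally show ?thesis .
    qed
    then show ?thesis by (auto simp: K_def dist_norm)
  qed
  have lin: "linear (\<lambda>u. r *\<^sub>R L u)" for r using \<open>linear L\<close> by (rule linear_compose_scale_right)
  have "(\<Inter>v\<in>{v. norm (T v) = 1 \<and> f v > 0}. K v) \<noteq> {}"
  proof (rule Helly_indexed[where 't = 't])
    show "CARD('t) = DIM('e) + 1" by (rule dim)
    fix v assume v: "v \<in> {v. norm (T v) = 1 \<and> f v > 0}"
    show "convex (K v)" unfolding K_vimage using lin by (rule convex_linear_vimage) simp
    show "compact (K v)"
    proof (rule compact_eq_bounded_closed[THEN iffD2], intro conjI)
      show "closed (K v)"
        unfolding K_vimage
        using linear_continuous_on[OF linear_linear[THEN iffD2, OF lin]]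
        by (intro closed_vimage) auto
      show "bounded (K v)"
        unfolding bounded_iff
      proof (intro exI ballI)
        fix u assume "u \<in> K v"
        then have "norm (T (v - f v *\<^sub>R (0, 1)) - f v *\<^sub>R L u) \<le> c"
          by (simp add: K_vimage dist_norm)
        then have "norm (f v *\<^sub>R L u) \<le> c + norm (T (v - f v *\<^sub>R (0, 1)))"
          by (smt (verit) norm_minus_commute norm_triangle_sub)
        moreover have "f v * (B * norm u) \<le> norm (f v *\<^sub>R L u)"
          using v L_below[of u] by simp
        ultimately have "norm u * (f v * B) \<le> c + norm (T (v - f v *\<^sub>R (0, 1)))"
          by (simp add: mult_ac)
        then show "norm u \<le> (c + norm (T (v - f v *\<^sub>R (0, 1)))) / (f v * B)"
          using v B(1) by (simp add: pos_le_divide_eq)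
      qed
    qed
  next
    fix y :: "'t \<Rightarrow> 'e \<times> real" assume "\<And>i. y i \<in> {v. norm (T v) = 1 \<and> f v > 0}"
    then obtain x where x: "f x = 1" "\<And>i. norm (T (y i - f (y i) *\<^sub>R x)) \<le> c"
      using meet[of y] by auto
    then have "fst x \<in> (\<Inter>i. K (y i))" using \<psi>[OF x(1)] by (simp add: K_def)
    then show "(\<Inter>i. K (y i)) \<noteq> {}" by blast
  qed
  then obtain u where u: "\<And>v. norm (T v) = 1 \<Longrightarrow> f v > 0 \<Longrightarrow> norm (T (v - f v *\<^sub>R \<psi> u)) \<le> c"
    by (auto simp: K_def)
  have f_scale: "f (r *\<^sub>R v) = r * f v" for r v by (simp add: f_def)
  have bound: "norm (T (v - f v *\<^sub>R \<psi> u)) \<le> c * norm (T v)" for v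
  proof (cases "f v = 0")
    case True
    then show ?thesis using \<open>c \<ge> 1\<close> mult_right_mono[of 1 c "norm (T v)"] by simp
  next
    case False
    then have "v \<noteq> 0" by (auto simp: f_def)
    then have "T v \<noteq> 0" using linear_injective_0[OF \<open>linear T\<close>] \<open>inj T\<close> by blast
    define r where "r = sgn (f v) / norm (T v)"
    have "norm (T (r *\<^sub>R v)) = 1"
      using False \<open>T v \<noteq> 0\<close> by (simp add: T.scale r_def abs_sgn_eq)
    moreover have "f (r *\<^sub>R v) > 0"
      using False \<open>T v \<noteq> 0\<close> by (simp add: f_scale r_def sgn_if)
    ultimately have "norm (T (r *\<^sub>R v - f (r *\<^sub>R v) *\<^sub>R \<psi> u)) \<le> c" by (rule u)
    also have "r *\<^sub>R v - f (r *\<^sub>R v) *\<^sub>R \<psi> u = r *\<^sub>R (v - f v *\<^sub>R \<psi> u)"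
      by (simp add: f_scale scaleR_diff_right)
    finally have "\<bar>r\<bar> * norm (T (v - f v *\<^sub>R \<psi> u)) \<le> c" by (simp only: T.scale norm_scaleR)
    moreover have "\<bar>r\<bar> = 1 / norm (T v)" using False by (simp add: r_def abs_sgn_eq)
    ultimately show ?thesis using \<open>T v \<noteq> 0\<close> by (simp add: pos_divide_le_eq)
  qed
  show ?thesis using f\<psi> bound by blast
qed

text \<open>If no projection onto the kernel of \<open>f\<close> beats \<open>2 - 2 / n\<close>, then for each smaller bound some \<open>n\<close> unit
  vectors obstruct it. For a limit of such families no point of height one
  stays strictly below \<open>2 - 2 / n\<close> at all indices, so the limit falls under the equality case of the estimate for \<open>n\<close> vectors.\<close>

lemma extremal_hyperplane_tight:
  fixes T :: "'e::euclidean_space \<times> real \<Rightarrow> 'a::real_normed_vector" and a :: 'e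
  assumes "linear T" "inj T" and dim: "CARD('t::finite) = DIM('e) + 1" and n3: "CARD('t) \<ge> 3"
  defines "f \<equiv> \<lambda>v. (a, 1) \<bullet> v"
  assumes extremal: "\<And>x c. \<lbrakk>c < 2 - 2 / real CARD('t); f x = 1;
      \<And>v. norm (T (v - f v *\<^sub>R x)) \<le> c * norm (T v)\<rbrakk> \<Longrightarrow> False"
  shows "\<exists>(y :: 't \<Rightarrow> 'e \<times> real) \<alpha>. \<alpha> > 0 \<and> (\<forall>i. norm (T (y i)) = 1) \<and> (\<forall>i. f (y i) = \<alpha>) \<and>
      (\<forall>i. norm (T (real CARD('t) *\<^sub>R y i - (\<Sum>j\<in>UNIV. y j))) = 2 * real CARD('t) - 2)"
proof -
  interpret T: linear T by fact
  have "bounded_linear T" using \<open>linear T\<close> linear_linear by blast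
  note T_tendsto = bounded_linear.tendsto[OF this]
  define C where "C = 2 - 2 / real CARD('t)"
  have C: "C \<ge> 4 / 3" using n3 by (simp add: C_def field_simps)
  \<comment> \<open>Bounds that increase to \<open>C\<close> without falling below \<open>1\<close>.\<close>
  define c where "c k = C - (1 / 3) * inverse (real (Suc k))" for k
  have c_less: "c k < C" for k by (simp add: c_def)
  have c_ge: "c k \<ge> 1" for k
  proof -
    have "inverse (real (Suc k)) \<le> 1" by (simp add: inverse_le_1_iff)
    then show ?thesis using C by (simp add: c_def)
  qed
  have c_lim: "c \<longlonglongrightarrow> C"
  proof -
    have "(\<lambda>k. C - (1 / 3) * inverse (real (Suc k))) \<longlonglongrightarrow> C - (1 / 3) * 0"
      by (intro tendsto_intros LIMSEQ_inverse_real_of_nat)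
    then show ?thesis by (simp add: c_def[abs_def])
  qed
  have "\<exists>y :: 't \<Rightarrow> 'e \<times> real. (\<forall>i. norm (T (y i)) = 1 \<and> f (y i) > 0) \<and>
      (\<forall>x. f x = 1 \<longrightarrow> (\<exists>i. norm (T (y i - f (y i) *\<^sub>R x)) > c k))" for k
  proof (rule ccontr)
    assume "\<not> ?thesis"
    then have "\<exists>x. f x = 1 \<and> (\<forall>i. norm (T (y i - f (y i) *\<^sub>R x)) \<le> c k)"
      if "\<And>i. norm (T (y i)) = 1 \<and> f (y i) > 0" for y :: "'t \<Rightarrow> 'e \<times> real"
      using that by (meson not_le)
    then have "\<exists>x. f x = 1 \<and> (\<forall>v. norm (T (v - f v *\<^sub>R x)) \<le> c k * norm (T v))"
      using Helly_projection[OF assms(1,2) dim c_ge[of k], of a] unfolding f_def by blast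
    then show False using extremal[OF c_less[of k, unfolded C_def]] by blast
  qed
  then obtain y :: "nat \<Rightarrow> 't \<Rightarrow> 'e \<times> real" where y:
    "\<And>k i. norm (T (y k i)) = 1" "\<And>k i. f (y k i) > 0"
    "\<And>k x. f x = 1 \<Longrightarrow> \<exists>i. norm (T (y k i - f (y k i) *\<^sub>R x)) > c k"
    by metis
  obtain B where B: "B > 0" "\<And>v. B * norm v \<le> norm (T v)"
    by (rule linear_inj_bounded_below[OF assms(1,2)]) (rule that)
  define Z :: "nat \<Rightarrow> ('e \<times> real)^'t" where "Z k = (\<chi> i. y k i)" for k
  have "bounded (range Z)"
    unfolding bounded_iff
  proof (intro exI ballI)
    fix z assume "z \<in> range Z"
    then obtain k where k: "z = Z k" by blast
    have "norm (y k i) \<le> 1 / B" for i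
      using B(2)[of "y k i"] y(1)[of k i] B(1) by (simp add: field_simps)
    then have "(\<Sum>i\<in>UNIV. norm (Z k $ i)) \<le> (\<Sum>i\<in>(UNIV::'t set). 1 / B)"
      by (intro sum_mono) (simp add: Z_def)
    moreover have "norm (Z k) \<le> (\<Sum>i\<in>UNIV. norm (Z k $ i))"
      unfolding norm_vec_def by (rule L2_set_le_sum) simp
    ultimately show "norm z \<le> (\<Sum>i\<in>(UNIV::'t set). 1 / B)" using k by simp
  qed
  then obtain l r where r: "strict_mono (r :: nat \<Rightarrow> nat)" and lim: "(Z \<circ> r) \<longlonglongrightarrow> l"
    using bounded_imp_convergent_subsequence by blast
  have lim_y: "(\<lambda>k. y (r k) i) \<longlonglongrightarrow> l $ i" for i
    using tendsto_vec_nth[OF lim, of i] by (simp add: Z_def)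
  have lim_f: "(\<lambda>k. f (y (r k) i)) \<longlonglongrightarrow> f (l $ i)" for i
    unfolding f_def by (intro tendsto_intros lim_y)
  have unit: "norm (T (l $ i)) = 1" for i
    using tendsto_norm[OF T_tendsto[OF lim_y[of i]]] by (simp add: y(1) LIMSEQ_const_iff)
  have nonneg: "f (l $ i) \<ge> 0" for i
    using lim_f[of i] by (rule LIMSEQ_le_const) (use y(2) in \<open>auto intro: less_imp_le\<close>)
  have no_point: False if fx: "f x = 1" and x: "\<And>i. norm (T (l $ i - f (l $ i) *\<^sub>R x)) < C" for x
  proof -
    have "\<forall>\<^sub>F k in sequentially. norm (T (y (r k) i - f (y (r k) i) *\<^sub>R x)) - c (r k) < 0" for i
    proof (rule order_tendstoD(2))
      show "(\<lambda>k. norm (T (y (r k) i - f (y (r k) i) *\<^sub>R x)) - c (r k))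
          \<longlonglongrightarrow> norm (T (l $ i - f (l $ i) *\<^sub>R x)) - C"
        using LIMSEQ_subseq_LIMSEQ[OF c_lim r]
        by (intro tendsto_intros T_tendsto lim_y lim_f) (simp add: o_def)
    qed (use x in simp)
    then have "\<forall>\<^sub>F k in sequentially. \<forall>i. norm (T (y (r k) i - f (y (r k) i) *\<^sub>R x)) - c (r k) < 0"
      by (simp add: eventually_all_finite)
    then obtain k where "\<And>i. norm (T (y (r k) i - f (y (r k) i) *\<^sub>R x)) - c (r k) < 0"
      using eventually_happens'[OF sequentially_bot] by blast
    then show False using y(3)[OF fx, of "r k"] by (meson diff_gt_0_iff_gt less_asym less_iff_diff_less_0)
  qed
  \<comment> \<open>If all limit heights vanish, any point of height one serves, because \<open>C > 1\<close>.\<close>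
  have "\<exists>i. f (l $ i) > 0"
  proof (rule ccontr)
    assume none: "\<nexists>i. f (l $ i) > 0"
    have "f (l $ i) = 0" for i
    proof -
      have "\<not> f (l $ i) > 0" using none by blast
      then show ?thesis using nonneg[of i] by linarith
    qed
    then show False using no_point[of "(0, 1)"] unit C by (simp add: f_def flip: zero_prod_def)
  qed
  then have ex: "\<exists>i\<in>UNIV. f (l $ i) > 0" by blast
  show ?thesis
  proof (rule common_point_or_tight[of "UNIV :: 't set" "\<lambda>i. T (l $ i)" "\<lambda>i. f (l $ i)"])
    fix w :: "'t \<Rightarrow> real"
    assume one: "(\<Sum>i\<in>UNIV. f (l $ i) * w i) = 1"
      and point: "\<And>i. i \<in> UNIV \<Longrightarrow> norm (T (l $ i) - f (l $ i) *\<^sub>R (\<Sum>j\<in>UNIV. w j *\<^sub>R T (l $ j)))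
          < 2 - 2 / real (card (UNIV :: 't set))"
    define x where "x = (\<Sum>j\<in>UNIV. w j *\<^sub>R l $ j)"
    have "f x = 1"
      using one by (simp add: x_def f_def inner_sum_right mult.commute)
    moreover have "norm (T (l $ i - f (l $ i) *\<^sub>R x)) < C" for i
      using point[of i] by (simp add: x_def C_def T.diff T.scale T.sum)
    ultimately have False by (rule no_point)
    then show ?thesis ..
  next
    fix \<alpha> :: real
    assume "\<alpha> > 0" "\<And>i. i \<in> UNIV \<Longrightarrow> f (l $ i) = \<alpha>"
      "\<And>i. i \<in> UNIV \<Longrightarrow> norm (real (card (UNIV :: 't set)) *\<^sub>R T (l $ i) - (\<Sum>j\<in>UNIV. T (l $ j)))
          = 2 * real (card (UNIV :: 't set)) - 2"
    then show ?thesis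
      using unit by (intro exI[of _ "\<lambda>i. l $ i"] exI[of _ \<alpha>]) (simp add: T.diff T.scale T.sum)
  qed (use n3 unit nonneg ex in auto)
qed

text \<open>For a basis vector \<open>b\<close> the functionals \<open>(t b, 1)\<close> with real \<open>t\<close> have pairwise
  different kernels. If all were extremal, each
  would be a multiple of a sum of \<open>n\<close> local gradients, so that \<open>t\<close> could be read off from that sum as
  the quotient of its values at \<open>(b, 0)\<close> and \<open>(0, 1)\<close>. There are only countably many sums.\<close>

lemma ex_small_projection:
  fixes T :: "'e::euclidean_space \<times> real \<Rightarrow> 'a::real_normed_vector"
  assumes "linear T" "inj T" and dim: "CARD('t::finite) = DIM('e) + 1" and n3: "CARD('t) \<ge> 3"
  shows "\<exists>(a :: 'e) x c. c < 2 - 2 / real CARD('t) \<and> (a, 1) \<bullet> x = 1 \<and>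
      (\<forall>v. norm (T (v - ((a, 1) \<bullet> v) *\<^sub>R x)) \<le> c * norm (T v))"
proof (rule ccontr)
  assume no: "\<not> ?thesis"
  define G where "G = local_gradients (\<lambda>v. norm (T v))"
  define \<Sigma> where "\<Sigma> = (\<lambda>g v. \<Sum>i\<in>UNIV. g i v) ` {g :: 't \<Rightarrow> 'e \<times> real \<Rightarrow> real. \<forall>i. g i \<in> G}"
  have "{g :: 't \<Rightarrow> 'e \<times> real \<Rightarrow> real. \<forall>i. g i \<in> G} = (\<Pi>\<^sub>E i\<in>UNIV. G)" by auto
  moreover have "countable (\<Pi>\<^sub>E i\<in>(UNIV :: 't set). G)"
    by (rule countable_PiE) (simp_all add: G_def countable_local_gradients)
  ultimately have "countable \<Sigma>" by (simp add: \<Sigma>_def)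
  obtain b :: 'e where "b \<in> Basis" using nonempty_Basis by blast
  have "t \<in> (\<lambda>s. s (b, 0) / s (0, 1)) ` \<Sigma>" for t :: real
  proof -
    define f where "f v = (t *\<^sub>R b, 1::real) \<bullet> v" for v
    have "linear f" unfolding f_def[abs_def] by (rule linearI) (simp_all add: inner_add_right)
    have "\<exists>(y :: 't \<Rightarrow> 'e \<times> real) \<alpha>. \<alpha> > 0 \<and> (\<forall>i. norm (T (y i)) = 1) \<and> (\<forall>i. f (y i) = \<alpha>) \<and>
      (\<forall>i. norm (T (real CARD('t) *\<^sub>R y i - (\<Sum>j\<in>UNIV. y j))) = 2 * real CARD('t) - 2)"
      unfolding f_def by (rule extremal_hyperplane_tight[OF assms]) (use no in blast)
    then obtain y :: "'t \<Rightarrow> 'e \<times> real" and \<alpha> where y: "\<alpha> > 0" "\<And>i. norm (T (y i)) = 1"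
      "\<And>i. f (y i) = \<alpha>"
      "\<And>i. norm (T (real CARD('t) *\<^sub>R y i - (\<Sum>j\<in>UNIV. y j))) = 2 * real CARD('t) - 2"
      by blast
    obtain g where g: "\<And>i. g i \<in> G"
      "\<And>v. \<alpha> * (\<Sum>i\<in>(UNIV :: 't set). g i v) = (2 - real CARD('t)) * f v"
      using tight_functional[OF \<open>linear T\<close> _ n3 y(2) y(4) \<open>linear f\<close> y(3)] dim
      unfolding G_def by auto
    define s where "s v = (\<Sum>i\<in>UNIV. g i v)" for v
    have "s \<in> \<Sigma>" unfolding \<Sigma>_def s_def[abs_def] using g(1) by blast
    moreover have "t = s (b, 0) / s (0, 1)"
    proof -
      have s: "s v = (2 - real CARD('t)) / \<alpha> * f v" for v
        using g(2)[of v] y(1) by (simp add: s_def field_simps)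
      have "f (b, 0) = t" "f (0, 1) = 1" using \<open>b \<in> Basis\<close> by (simp_all add: f_def)
      then show ?thesis using y(1) n3 by (simp add: s)
    qed
    ultimately show ?thesis by (intro rev_image_eqI[of s])
  qed
  then have "UNIV \<subseteq> (\<lambda>s. s (b, 0) / s (0, 1)) ` \<Sigma>" by blast
  then have "countable (UNIV :: real set)"
    using \<open>countable \<Sigma>\<close> by (meson countable_image countable_subset)
  then show False using uncountable_UNIV_real by blast
qed

section \<open>Transfer to the given space\<close>

text \<open>An index type with one element fewer than the dimension of the space \<open>'a\<close>. It makes
  \<open>real ^ 'a coord_index\<close> a Euclidean space of the dimension of a hyperplane, and its product with
  \<open>real\<close> a coordinate space for \<open>'a\<close>. The maximum with \<open>1\<close> keeps the type inhabited in dimension below two.\<close>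
typedef (overloaded) ('a::real_normed_vector) coord_index =
    "{..<max 1 (dim (UNIV :: 'a set) - 1)} :: nat set"
  by (rule exI[of _ 0]) simp

lemma bij_betw_Rep_coord_index:
  "bij_betw (Rep_coord_index :: 'a::real_normed_vector coord_index \<Rightarrow> nat) UNIV
     {..<max 1 (dim (UNIV :: 'a set) - 1)}"
  unfolding bij_betw_def using type_definition.Rep_range[OF type_definition_coord_index]
  by (auto simp: inj_on_def Rep_coord_index_inject)

instance coord_index :: (real_normed_vector) finite
proof
  show "finite (UNIV :: 'a coord_index set)"
    using bij_betw_finite[OF bij_betw_Rep_coord_index] by blast
qed

lemma card_coord_index:
  "CARD('a::real_normed_vector coord_index) = max 1 (dim (UNIV :: 'a set) - 1)"
  using bij_betw_same_card[OF bij_betw_Rep_coord_index] by simp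

lemma ex_coordinates:
  assumes "dim (UNIV :: 'a::real_normed_vector set) = DIM('b::euclidean_space)"
  obtains T :: "'b::euclidean_space \<Rightarrow> 'a::real_normed_vector" and R where "linear T" "linear R" "\<And>v. R (T v) = v" "\<And>z. T (R z) = z"
proof -
  obtain B :: "'a set" where "B \<subseteq> UNIV"
    and B: "independent B" "UNIV \<subseteq> span B" "card B = dim (UNIV :: 'a set)"
    by (rule basis_exists) (rule that)
  have "finite B" by (rule card_ge_0_finite) (simp add: B(3) assms)
  then obtain h where h: "bij_betw h (Basis :: 'b set) B"
    using finite_same_card_bij[of "Basis :: 'b set" B] B(3) assms by auto
  obtain T where T: "linear T" "\<forall>b\<in>Basis. T b = h b"
    using linear_independent_extend[OF independent_Basis, of h] by blast
  obtain R where R: "linear R" "\<forall>z\<in>B. R z = inv_into Basis h z"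
    using linear_independent_extend[OF B(1), of "inv_into Basis h"] by blast
  show thesis
  proof
    show "R (T v) = v" for v
    proof (rule linear_eq_on_span[of "\<lambda>v. R (T v)" "\<lambda>v. v" "Basis :: 'b set"])
      show "linear (\<lambda>v. R (T v))" using linear_compose[OF T(1) R(1)] by (simp add: o_def)
      show "linear (\<lambda>v :: 'b. v)" by (rule linear_ident)
      show "R (T b) = b" if "b \<in> Basis" for b
        using that T(2) R(2) h by (auto simp: bij_betw_def)
    qed simp
    show "T (R z) = z" for z
    proof (rule linear_eq_on_span[of "\<lambda>z. T (R z)" "\<lambda>z. z" B])
      show "linear (\<lambda>z. T (R z))" using linear_compose[OF R(1) T(1)] by (simp add: o_def)
      show "linear (\<lambda>z :: 'a. z)" by (rule linear_ident)
      show "T (R z) = z" if "z \<in> B" for z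
        using that T(2) R(2) h by (metis bij_betw_def f_inv_into_f inv_into_into)
      show "z \<in> span B" using B(2) by blast
    qed
  qed (rule T(1) R(1))+
qed


theorem corollary2p8:
  fixes n :: nat
  assumes "n \<ge> 3"
    and "dim (UNIV :: 'a::real_normed_vector set) = n"
  shows "\<exists>Y :: 'a set. subspace Y \<and> dim Y = n - 1 \<and>
           rel_proj_const Y < ereal (2 - 2 / real n)"
proof -
  have card: "CARD('a coord_index) = n - 1"
    using assms by (simp add: card_coord_index)
  then have dim: "DIM((real ^ 'a coord_index) \<times> real) = n"
    using assms(1) by simp
  then obtain T :: "(real ^ 'a coord_index) \<times> real \<Rightarrow> 'a" and R
    where T: "linear T" and R: "linear R" and RT: "\<And>v. R (T v) = v" and TR: "\<And>z. T (R z) = z"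
    using ex_coordinates[where 'a = 'a and 'b = "(real ^ 'a coord_index) \<times> real"] assms(2)
    by metis
  interpret T: linear T by fact
  interpret R: linear R by fact
  have "inj T" by (metis RT injI)
  have n: "CARD('a coord_index option) = n" using card assms(1) by simp
  obtain a :: "real ^ 'a coord_index" and x c where c: "c < 2 - 2 / real n"
    and x: "(a, 1) \<bullet> x = 1"
    and bound: "\<And>v. norm (T (v - ((a, 1) \<bullet> v) *\<^sub>R x)) \<le> c * norm (T v)"
    using ex_small_projection[where 't = "'a coord_index option", OF T \<open>inj T\<close>] n card assms(1)
    by auto
  define H where "H = {v :: (real ^ 'a coord_index) \<times> real. (a, 1) \<bullet> v = 0}"
  define P where "P z = T (R z - ((a, 1) \<bullet> R z) *\<^sub>R x)" for z
  have "subspace (T ` H)"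
    unfolding H_def by (rule linear_subspace_image[OF T subspace_hyperplane])
  moreover have "dim (T ` H) = n - 1"
  proof -
    have "dim (T ` H) = dim H"
      using dim_image_eq[OF T inj_on_subset[OF \<open>inj T\<close> subset_UNIV]] .
    also have "\<dots> = n - 1"
      unfolding H_def using dim_hyperplane[of "(a, 1::real)"] dim by (auto simp: zero_prod_def)
    finally show ?thesis .
  qed
  moreover have "rel_proj_const (T ` H) < ereal (2 - 2 / real n)"
  proof -
    have P_bound: "norm (P z) \<le> c * norm z" for z
      using bound[of "R z"] by (simp add: P_def TR)
    have "is_projection_onto P (T ` H)"
      unfolding is_projection_onto_def
    proof (intro conjI allI ballI)
      show "bounded_linear P"
      proof (rule bounded_linear_intro)
        show "P (y + z) = P y + P z" for y z
          by (simp add: P_def R.add inner_add_right scaleR_left_distrib T.add T.diff T.scale)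
        show "P (r *\<^sub>R z) = r *\<^sub>R P z" for r z
          by (simp add: P_def R.scale T.diff T.scale scaleR_diff_right)
        show "norm (P z) \<le> norm z * c" for z using P_bound[of z] by (simp add: mult.commute)
      qed
      show "P z \<in> T ` H" for z
        unfolding P_def by (rule imageI) (simp add: H_def inner_diff_right x)
      show "P z = z" if "z \<in> T ` H" for z
        using that by (auto simp: P_def H_def RT)
    qed
    then have "rel_proj_const (T ` H) \<le> ereal (onorm P)"
      unfolding rel_proj_const_def by (intro INF_lower) simp
    also have "onorm P \<le> c"
    proof (rule onorm_bound)
      have "x \<noteq> 0" using x by auto
      then have "T x \<noteq> 0" using RT[of x] R.zero by metis
      moreover have "0 \<le> c * norm (T x)" using order_trans[OF norm_ge_zero bound[of x]] .
      ultimately show "0 \<le> c" by (simp add: zero_le_mult_iff)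
    qed (rule P_bound)
    finally show ?thesis using c by (simp add: order_le_less_trans)
  qed
  ultimately show ?thesis by blast
qed

end
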